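(* Let $D=(V,A)$ be a digraph, $w\in\mathbb{R}_{\ge0}^A$, and $b\in\mathbb{Z}_{>0}^V$. Define $g:\mathbb{Z}^V\to\mathbb{R}\cup\{+\infty\}$ by $$g(x)=\min\{w(B): B \text{ is a } b\text{-branching in } D,\ d^-_B+x\ge b\}$$ if $x\in\mathbb{Z}_{\ge0}^V$ and $D$ has a $b$-branching $B$ with $d^-_B+x\ge b$, and $g(x)=+\infty$ otherwise. Then $g$ is $\mathrm{M}^\natural$-convex.
   Context: Digraphs are loopless. $d^-_B\in\mathbb{Z}^V$ is the vector of indegrees in $(V,B)$; $w(B)=\sum_{a\in B}w(a)$; $B[X]$ is the set of arcs of $B$ with both ends in $X$, $b(X)=\sum_{v\in X}b(v)$. An arc set $B\subseteq A$ is a $b$-branching if $d^-_B(v)\le b(v)$ for all $v\in V$ and $|B[X]|\le b(X)-1$ for every nonempty $X\subseteq V$. For $x\in\mathbb{Z}^V$, $\mathrm{supp}^+(x)=\{v:x(v)>0\}$, $\mathrm{supp}^-(x)=\{v:x(v)<0\}$, and $\chi_v$ is the unit vector of $v$. A function $f:\mathbb{Z}^V\to\mathbb{R}\cup\{+\infty\}$ is $\mathrm{M}^\natural$-convex if for all $x,y\in\mathbb{Z}^V$ and $u\in\mathrm{supp}^+(x-y)$, either $f(x)+f(y)\ge f(x-\chi_u)+f(y+\chi_u)$, or there is $v\in\mathrm{supp}^-(x-y)$ with $f(x)+f(y)\ge f(x-\chi_u+\chi_v)+f(y+\chi_u-\chi_v)$. *)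

theory Defs
  imports "HOL-Library.Extended_Real"
begin

text \<open>A digraph D = (V, A): vertices are the elements of a finite type 'v (so V = UNIV and
Z^V = 'v => int); arcs are the elements of a finite set A of arc names of type 'e, with
tail and head maps (parallel arcs allowed), loopless.\<close>

definition digraph :: "'e set \<Rightarrow> ('e \<Rightarrow> 'v) \<Rightarrow> ('e \<Rightarrow> 'v) \<Rightarrow> bool" where
  "digraph A tail head \<longleftrightarrow> finite A \<and> (\<forall>a\<in>A. tail a \<noteq> head a)"

definition indeg :: "('e \<Rightarrow> 'v) \<Rightarrow> 'e set \<Rightarrow> 'v \<Rightarrow> int" where
  "indeg head B v = int (card {a\<in>B. head a = v})"

definition induced_arcs :: "('e \<Rightarrow> 'v) \<Rightarrow> ('e \<Rightarrow> 'v) \<Rightarrow> 'e set \<Rightarrow> 'v set \<Rightarrow> 'e set" where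
  "induced_arcs tail head B X = {a\<in>B. tail a \<in> X \<and> head a \<in> X}"

definition b_branching ::
  "'e set \<Rightarrow> ('e \<Rightarrow> 'v) \<Rightarrow> ('e \<Rightarrow> 'v) \<Rightarrow> ('v \<Rightarrow> int) \<Rightarrow> 'e set \<Rightarrow> bool" where
  "b_branching A tail head b B \<longleftrightarrow> B \<subseteq> A \<and>
     (\<forall>v. indeg head B v \<le> b v) \<and>
     (\<forall>X. X \<noteq> {} \<longrightarrow> int (card (induced_arcs tail head B X)) \<le> sum b X - 1)"

definition feas ::
  "'e set \<Rightarrow> ('e \<Rightarrow> 'v) \<Rightarrow> ('e \<Rightarrow> 'v) \<Rightarrow> ('v \<Rightarrow> int) \<Rightarrow> ('v \<Rightarrow> int) \<Rightarrow> 'e set set" where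
  "feas A tail head b x = {B. b_branching A tail head b B \<and> (\<forall>v. indeg head B v + x v \<ge> b v)}"

definition gfun ::
  "'e set \<Rightarrow> ('e \<Rightarrow> 'v) \<Rightarrow> ('e \<Rightarrow> 'v) \<Rightarrow> ('e \<Rightarrow> real) \<Rightarrow> ('v \<Rightarrow> int) \<Rightarrow> ('v \<Rightarrow> int) \<Rightarrow> ereal" where
  "gfun A tail head w b x =
     (if (\<forall>v. x v \<ge> 0) \<and> feas A tail head b x \<noteq> {}
      then ereal (Min ((\<lambda>B. sum w B) ` feas A tail head b x))
      else \<infinity>)"

definition supp_pos :: "('v \<Rightarrow> int) \<Rightarrow> 'v set" where
  "supp_pos x = {v. x v > 0}"

definition supp_neg :: "('v \<Rightarrow> int) \<Rightarrow> 'v set" where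
  "supp_neg x = {v. x v < 0}"

definition unitv :: "'v \<Rightarrow> 'v \<Rightarrow> int" where
  "unitv u = (\<lambda>v. if v = u then 1 else 0)"

definition Mnat_convex :: "(('v \<Rightarrow> int) \<Rightarrow> ereal) \<Rightarrow> bool" where
  "Mnat_convex f \<longleftrightarrow> (\<forall>x. f x \<noteq> -\<infinity>) \<and>
     (\<forall>x y. \<forall>u\<in>supp_pos (\<lambda>i. x i - y i).
        f x + f y \<ge> f (\<lambda>i. x i - unitv u i) + f (\<lambda>i. y i + unitv u i) \<or>
        (\<exists>v\<in>supp_neg (\<lambda>i. x i - y i).
           f x + f y \<ge> f (\<lambda>i. x i - unitv u i + unitv v i) + f (\<lambda>i. y i + unitv u i - unitv v i)))"

end

(* For an arc set B with indegrees at most b, put r = b - d^-_B. Counting arcs by their heads, B is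
   a b-branching iff every nonempty X is entered by an arc of B or contains a vertex with r > 0,
   i.e. iff every vertex is reachable in B from the support of r. By Edmonds' theorem on disjoint
   branchings, the arcs of two b-branchings with deficits r1, r2 can be redistributed, without
   changing the total weight, into two b-branchings with prescribed deficits s1, s2, where
   s1 + s2 = r1 + r2, provided that s1 and s2 are both nonzero on every nonempty set that no arc
   enters. If r1(u) > r2(u), then moving one unit of deficit at u from the first to the second
   b-branching is only obstructed by a set X, entered by no arc, on which r1 is the unit vector
   of u; the smallest such X contains some v with r2(v) > 0, and moving one unit at v in the
   opposite direction repairs the obstruction. *)

theory Submission
  imports Defs "HOL-Library.Disjoint_Sets"
begin

section \<open>Edmonds' theorem on disjoint branchings with prescribed root sets\<close>

definition entering :: "('e \<Rightarrow> 'v) \<Rightarrow> ('e \<Rightarrow> 'v) \<Rightarrow> 'e set \<Rightarrow> 'v set \<Rightarrow> 'e set" where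
  "entering tail head F X = {a\<in>F. tail a \<notin> X \<and> head a \<in> X}"

lemma card_filter_eq_sum_of_bool:
  "finite S \<Longrightarrow> card {a\<in>S. P a} = (\<Sum>a\<in>S. of_bool (P a))"
  by (simp add: of_bool_def sum.If_cases Int_def)

text \<open>Holds arc by arc: an arc entering the intersection or the union enters at least one of
  the two sets, and an arc entering both the intersection and the union enters both sets.\<close>

lemma card_entering_submodular:
  assumes "finite D"
  shows "card (entering tail head D (X \<inter> Y)) + card (entering tail head D (X \<union> Y))
    \<le> card (entering tail head D X) + card (entering tail head D Y)"
  unfolding entering_def card_filter_eq_sum_of_bool[OF assms] sum.distrib[symmetric]
  by (rule sum_mono) auto

text \<open>The demand side of Edmonds' cut condition: for each of these indices the branching to be
  built needs an arc of its own that enters \<open>X\<close>.\<close>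

definition missing :: "('i \<Rightarrow> 'v set) \<Rightarrow> 'i set \<Rightarrow> 'v set \<Rightarrow> 'i set" where
  "missing R I X = {i\<in>I. R i \<inter> X = {}}"

lemma card_missing_supermodular:
  assumes "finite I"
  shows "card (missing R I X) + card (missing R I Y)
    \<le> card (missing R I (X \<inter> Y)) + card (missing R I (X \<union> Y))"
  unfolding missing_def card_filter_eq_sum_of_bool[OF assms] sum.distrib[symmetric]
  by (rule sum_mono) auto

text \<open>The index \<open>j\<close> contributes nothing on the left and one unit on the right. In
  the uncrossing argument this prevents two overlapping tight sets that meet \<open>R j\<close> from
  having an intersection that avoids \<open>R j\<close>.\<close>

lemma card_missing_supermodular_strict:
  assumes "finite I" "j \<in> I" "R j \<inter> X \<noteq> {}" "R j \<inter> Y \<noteq> {}" "R j \<inter> (X \<inter> Y) = {}"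
  shows "card (missing R I X) + card (missing R I Y)
    < card (missing R I (X \<inter> Y)) + card (missing R I (X \<union> Y))"
  unfolding missing_def card_filter_eq_sum_of_bool[OF assms(1)] sum.distrib[symmetric]
proof (rule sum_strict_mono_ex1[OF assms(1)])
  show "\<exists>i\<in>I. of_bool (R i \<inter> X = {}) + of_bool (R i \<inter> Y = {})
      < of_bool (R i \<inter> (X \<inter> Y) = {}) + (of_bool (R i \<inter> (X \<union> Y) = {}) :: nat)"
    using assms by (intro bexI[of _ j]) auto
qed auto

text \<open>The inductive step of Lovasz's proof of Edmonds' theorem.\<close>

lemma exists_extending_arc:
  fixes tail head :: "'e \<Rightarrow> 'v::finite" and R :: "'i \<Rightarrow> 'v set"
  assumes fin: "finite I" "finite D"
    and cut: "\<And>X. X \<noteq> {} \<Longrightarrow> card (missing R I X) \<le> card (entering tail head D X)"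
    and j: "j \<in> I" "R j \<noteq> UNIV"
  obtains a where "a \<in> D" "tail a \<in> R j" "head a \<notin> R j"
    "\<And>X. X \<noteq> {} \<Longrightarrow> card (missing (R(j := insert (head a) (R j))) I X)
        \<le> card (entering tail head (D - {a}) X)"
proof -
  let ?p = "\<lambda>X. card (missing R I X)" and ?\<rho> = "\<lambda>X. card (entering tail head D X)"
  \<comment> \<open>The tight sets that meet \<open>R j\<close> without lying inside it. Deleting an
    arc that leaves \<open>R j\<close> lowers the supply of every set it enters. If such a set
    avoids \<open>R j\<close>, its demand falls as well when the head joins \<open>R j\<close>;
    otherwise only tightness does harm.\<close>
  define bad where "bad X \<longleftrightarrow> ?\<rho> X = ?p X \<and> X \<inter> R j \<noteq> {} \<and> X - R j \<noteq> {}" for X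
  have "\<exists>a\<in>D. tail a \<in> R j \<and> head a \<notin> R j \<and>
      (\<forall>Y. bad Y \<longrightarrow> head a \<in> Y \<longrightarrow> tail a \<in> Y)"
  proof (cases "\<exists>X. bad X")
    case False
    have "j \<in> missing R I (- R j)" using j by (auto simp: missing_def)
    hence "0 < ?p (- R j)" using fin by (auto simp: card_gt_0_iff missing_def)
    also have "\<dots> \<le> ?\<rho> (- R j)" using j by (intro cut) blast
    finally obtain a where "a \<in> entering tail head D (- R j)"
      by (metis card.empty ex_in_conv less_irrefl)
    with False show ?thesis by (auto simp: entering_def)
  next
    case True
    then obtain X where X: "bad X" and min: "\<And>Y. bad Y \<Longrightarrow> card X \<le> card Y"
      using ex_has_least_nat[of bad _ card] by blast
    \<comment> \<open>Besides all root sets avoiding \<open>X\<close>, also \<open>R j\<close>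
      avoids \<open>X - R j\<close>. So the demand of \<open>X - R j\<close>, and with it the
      supply, exceeds the supply of the tight set \<open>X\<close>, and some arc entering
      \<open>X - R j\<close> starts in \<open>X \<inter> R j\<close>.\<close>
    have "insert j (missing R I X) \<subseteq> missing R I (X - R j)" "j \<notin> missing R I X"
      using X j by (auto simp: bad_def missing_def)
    hence "?p X < ?p (X - R j)"
      using fin by (intro psubset_card_mono) (auto simp: missing_def)
    also have "\<dots> \<le> ?\<rho> (X - R j)" using X by (intro cut) (auto simp: bad_def)
    finally have "?\<rho> X < ?\<rho> (X - R j)" using X by (simp add: bad_def)
    hence "\<not> entering tail head D (X - R j) \<subseteq> entering tail head D X"
      using fin card_mono[of "entering tail head D X" "entering tail head D (X - R j)"]
      by (simp add: entering_def not_le[symmetric]) blast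
    then obtain a where a: "a \<in> D" "tail a \<in> X" "tail a \<in> R j" "head a \<in> X" "head a \<notin> R j"
      by (auto simp: entering_def)
    \<comment> \<open>Uncrossing: otherwise \<open>X \<inter> Y\<close> would be tight, meet
      \<open>R j\<close> and contain \<open>head a\<close> outside \<open>R j\<close>, hence be bad.
      Lacking \<open>tail a\<close>, it would be smaller than the minimal \<open>X\<close>.\<close>
    have "tail a \<in> Y" if Y: "bad Y" "head a \<in> Y" for Y
    proof (rule ccontr)
      assume n: "tail a \<notin> Y"
      have ne: "X \<inter> Y \<noteq> {}" "X \<union> Y \<noteq> {}" using a Y by auto
      note sub = card_entering_submodular[OF fin(2), of tail head X Y]
      note sup = card_missing_supermodular[OF fin(1), of R X Y]
      have tight: "?\<rho> X = ?p X" "?\<rho> Y = ?p Y" using X Y by (auto simp: bad_def)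
      have "?\<rho> (X \<inter> Y) = ?p (X \<inter> Y)"
        using sub sup tight cut[OF ne(1)] cut[OF ne(2)] by linarith
      moreover have "R j \<inter> (X \<inter> Y) \<noteq> {}"
      proof
        assume "R j \<inter> (X \<inter> Y) = {}"
        moreover have "R j \<inter> X \<noteq> {}" "R j \<inter> Y \<noteq> {}" using X Y by (auto simp: bad_def)
        ultimately show False
          using card_missing_supermodular_strict[OF fin(1) j(1), of R X Y]
            sub tight cut[OF ne(1)] cut[OF ne(2)] by linarith
      qed
      ultimately have "bad (X \<inter> Y)" using a Y by (auto simp: bad_def)
      moreover have "card (X \<inter> Y) < card X"
        by (rule psubset_card_mono) (use a n in auto)
      ultimately show False using min by fastforce
    qed
    with a show ?thesis by auto
  qed
  then obtain a where a: "a \<in> D" "tail a \<in> R j" "head a \<notin> R j"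
    and good: "\<And>Y. bad Y \<Longrightarrow> head a \<in> Y \<Longrightarrow> tail a \<in> Y" by auto
  show thesis
  proof (rule that[OF a])
    fix X :: "'v set" assume ne: "X \<noteq> {}"
    let ?R = "R(j := insert (head a) (R j))"
    have le: "card (missing ?R I X) \<le> ?p X"
      using fin by (intro card_mono) (auto simp: missing_def split: if_splits)
    show "card (missing ?R I X) \<le> card (entering tail head (D - {a}) X)"
    proof (cases "a \<in> entering tail head D X")
      case False
      hence "entering tail head (D - {a}) X = entering tail head D X"
        by (auto simp: entering_def)
      with le cut[OF ne] show ?thesis by simp
    next
      case True
      hence "entering tail head (D - {a}) X = entering tail head D X - {a}"
        by (auto simp: entering_def)
      hence eq: "card (entering tail head (D - {a}) X) = ?\<rho> X - 1"
        using True fin by (simp add: entering_def)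
      show ?thesis
      proof (cases "R j \<inter> X = {}")
        case True
        hence "missing ?R I X = missing R I X - {j}" "j \<in> missing R I X"
          using \<open>a \<in> entering tail head D X\<close> j
          by (auto simp: missing_def entering_def split: if_splits)
        hence "card (missing ?R I X) = ?p X - 1"
          using fin by (simp add: missing_def)
        with eq cut[OF ne] show ?thesis by simp
      next
        case False
        have "?\<rho> X \<noteq> ?p X"
        proof
          assume "?\<rho> X = ?p X"
          hence "bad X" using False True a by (auto simp: bad_def entering_def)
          with good True show False by (auto simp: entering_def)
        qed
        with cut[OF ne] le eq show ?thesis by linarith
      qed
    qed
  qed
qed

text \<open>Edmonds' theorem in cut form: by the second conclusion every vertex is reachable from
  \<open>R i\<close> in \<open>F i\<close>, and together with the third this makes \<open>F i\<close> a branching with root set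
  \<open>R i\<close>.\<close>

theorem edmonds_disjoint_branchings:
  fixes tail head :: "'e \<Rightarrow> 'v::finite" and R :: "'i \<Rightarrow> 'v set"
  assumes "finite I" "finite D"
    and "\<And>X. X \<noteq> {} \<Longrightarrow> card (missing R I X) \<le> card (entering tail head D X)"
  shows "\<exists>F. (\<forall>i\<in>I. F i \<subseteq> D) \<and> disjoint_family_on F I \<and>
    (\<forall>i\<in>I. \<forall>X. X \<noteq> {} \<longrightarrow> R i \<inter> X = {} \<longrightarrow> entering tail head (F i) X \<noteq> {}) \<and>
    (\<forall>i\<in>I. \<forall>v. card {a\<in>F i. head a = v} \<le> of_bool (v \<notin> R i))"
  using assms
\<comment> \<open>The measure counts the pairs of an index and a vertex outside its root set. Each
  step spends one arc and moves its head into one root set.\<close>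
proof (induction "\<Sum>i\<in>I. card (- R i)" arbitrary: R D rule: less_induct)
  case less
  show ?case
  proof (cases "\<forall>i\<in>I. R i = UNIV")
    case True
    thus ?thesis by (intro exI[of _ "\<lambda>_. {}"]) (auto simp: disjoint_family_on_def)
  next
    case False
    then obtain j where j: "j \<in> I" "R j \<noteq> UNIV" by blast
    obtain a where a: "a \<in> D" "tail a \<in> R j" "head a \<notin> R j"
      and cut: "\<And>X. X \<noteq> {} \<Longrightarrow> card (missing (R(j := insert (head a) (R j))) I X)
        \<le> card (entering tail head (D - {a}) X)"
      using exists_extending_arc[OF less.prems j] by blast
    let ?R = "R(j := insert (head a) (R j))"
    have "card (- insert (head a) (R j)) < card (- R j)"
      by (rule psubset_card_mono) (use a in auto)
    hence "(\<Sum>i\<in>I. card (- ?R i)) < (\<Sum>i\<in>I. card (- R i))"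
      using less.prems(1) j by (intro sum_strict_mono_ex1) (auto intro!: card_mono)
    from less.hyps[OF this less.prems(1) finite_Diff[OF less.prems(2)] cut] obtain F where
      "(\<forall>i\<in>I. F i \<subseteq> D - {a}) \<and> disjoint_family_on F I \<and>
        (\<forall>i\<in>I. \<forall>X. X \<noteq> {} \<longrightarrow> ?R i \<inter> X = {} \<longrightarrow> entering tail head (F i) X \<noteq> {}) \<and>
        (\<forall>i\<in>I. \<forall>v. card {a\<in>F i. head a = v} \<le> of_bool (v \<notin> ?R i))" ..
    hence F: "\<And>i. i \<in> I \<Longrightarrow> F i \<subseteq> D - {a}" "disjoint_family_on F I"
      "\<And>i X. i \<in> I \<Longrightarrow> X \<noteq> {} \<Longrightarrow> ?R i \<inter> X = {} \<Longrightarrow> entering tail head (F i) X \<noteq> {}"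
      "\<And>i v. i \<in> I \<Longrightarrow> card {a\<in>F i. head a = v} \<le> of_bool (v \<notin> ?R i)"
      by blast+
    let ?F = "F(j := insert a (F j))"
    have "\<forall>i\<in>I. ?F i \<subseteq> D" using F(1) a by (auto split: if_splits)
    moreover have "disjoint_family_on ?F I"
      using F(1,2) j unfolding disjoint_family_on_def by auto
    moreover have "entering tail head (?F i) X \<noteq> {}" if "i \<in> I" "X \<noteq> {}" "R i \<inter> X = {}" for i X
    proof (cases "i = j \<and> head a \<in> X")
      case True
      hence "a \<in> entering tail head (?F i) X" using that a by (auto simp: entering_def)
      thus ?thesis by blast
    next
      case False
      hence "entering tail head (F i) X \<noteq> {}" using that by (intro F(3)) auto
      thus ?thesis by (auto simp: entering_def split: if_splits)
    qed
    moreover have "card {a\<in>?F i. head a = v} \<le> of_bool (v \<notin> R i)" if i: "i \<in> I" for i v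
    proof -
      have fin: "finite {a\<in>F i. head a = v}"
        using F(1)[OF i] less.prems(2) by (auto intro: finite_subset)
      show ?thesis
      proof (cases "i = j \<and> v = head a")
        case True
        hence "{a'\<in>?F i. head a' = v} = insert a {a\<in>F i. head a = v}" by auto
        \<comment> \<open>The enlarged root set contains \<open>head a\<close>, so the branching
          from the induction hypothesis has no arc into it and \<open>a\<close> becomes the only
          one.\<close>
        moreover have "card {a\<in>F i. head a = v} = 0" using F(4)[OF i, of v] True by simp
        hence "{a\<in>F i. head a = v} = {}" using fin by simp
        ultimately have "{a'\<in>?F i. head a' = v} = {a}" by (simp only:)
        thus ?thesis using True a by (simp only: card.insert) simp
      next
        case False
        hence "{a'\<in>?F i. head a' = v} = {a\<in>F i. head a = v}" by auto
        thus ?thesis using F(4)[OF i, of v] False by (auto split: if_splits)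
      qed
    qed
    ultimately show ?thesis by (intro exI[of _ ?F]) blast
  qed
qed

section \<open>Indegrees and the cut form of b-branchings\<close>

lemma sum_indeg:
  fixes head :: "'e \<Rightarrow> 'v::finite"
  assumes "finite B"
  shows "sum (indeg head B) X
    = int (card (induced_arcs tail head B X)) + int (card (entering tail head B X))"
proof -
  have "sum (indeg head B) X = int (\<Sum>v\<in>X. card {a\<in>B. head a = v})"
    by (simp add: indeg_def)
  also have "(\<Sum>v\<in>X. card {a\<in>B. head a = v}) = card (\<Union>v\<in>X. {a\<in>B. head a = v})"
    using assms by (subst card_UN_disjoint) auto
  also have "(\<Union>v\<in>X. {a\<in>B. head a = v}) = induced_arcs tail head B X \<union> entering tail head B X"
    by (auto simp: induced_arcs_def entering_def)
  also have "card \<dots> = card (induced_arcs tail head B X) + card (entering tail head B X)"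
    using assms by (intro card_Un_disjoint) (auto simp: induced_arcs_def entering_def)
  finally show ?thesis by simp
qed

text \<open>The number of arcs inside \<open>X\<close> is the indegree sum over \<open>X\<close>
  minus the number of arcs entering \<open>X\<close>. Since the indegree sum is at most
  \<open>sum b X\<close>, the count stays strictly below \<open>sum b X\<close> exactly if one of
  these two quantities leaves room.\<close>

lemma b_branching_iff_entering:
  fixes head :: "'e \<Rightarrow> 'v::finite"
  assumes "finite A"
  shows "b_branching A tail head b B \<longleftrightarrow> B \<subseteq> A \<and> (\<forall>v. indeg head B v \<le> b v) \<and>
    (\<forall>X. X \<noteq> {} \<longrightarrow> (\<exists>v\<in>X. indeg head B v < b v) \<or> entering tail head B X \<noteq> {})"
proof -
  have "int (card (induced_arcs tail head B X)) \<le> sum b X - 1 \<longleftrightarrow>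
      (\<exists>v\<in>X. indeg head B v < b v) \<or> entering tail head B X \<noteq> {}"
    if B: "B \<subseteq> A" and le: "\<forall>v. indeg head B v \<le> b v" for X
  proof -
    have fin: "finite B" using B assms by (rule finite_subset)
    hence "card (entering tail head B X) = 0 \<longleftrightarrow> entering tail head B X = {}"
      by (simp add: entering_def)
    moreover have "sum (indeg head B) X \<le> sum b X" using le by (simp add: sum_mono)
    moreover have "sum (indeg head B) X < sum b X \<longleftrightarrow> (\<exists>v\<in>X. indeg head B v < b v)"
    proof
      show "\<exists>v\<in>X. indeg head B v < b v" if "sum (indeg head B) X < sum b X"
        using that by (meson linorder_not_le sum_mono)
      show "sum (indeg head B) X < sum b X" if "\<exists>v\<in>X. indeg head B v < b v"
        using that le by (intro sum_strict_mono_ex1) auto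
    qed
    ultimately show ?thesis using sum_indeg[OF fin, of head X tail] by linarith
  qed
  thus ?thesis by (simp add: b_branching_def cong: conj_cong)
qed

lemma indeg_Un_disjoint:
  assumes "finite B" "finite C" "B \<inter> C = {}"
  shows "indeg head (B \<union> C) v = indeg head B v + indeg head C v"
proof -
  have "{a \<in> B \<union> C. head a = v} = {a\<in>B. head a = v} \<union> {a\<in>C. head a = v}" by auto
  moreover have "card \<dots> = card {a\<in>B. head a = v} + card {a\<in>C. head a = v}"
    using assms by (intro card_Un_disjoint) auto
  ultimately show ?thesis by (simp add: indeg_def)
qed

lemma indeg_mono: "finite C \<Longrightarrow> B \<subseteq> C \<Longrightarrow> indeg head B v \<le> indeg head C v"
  unfolding indeg_def by (auto intro!: card_mono)

text \<open>The choice is made separately for each head \<open>v\<close>: the arcs of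
  \<open>G1\<close> into \<open>v\<close> are extended to \<open>n1 v\<close> arcs into
  \<open>v\<close> outside \<open>G2\<close>. The bound on the indegree of \<open>G2\<close> says
  that enough arcs are available.\<close>

lemma split_with_indeg:
  fixes head :: "'e \<Rightarrow> 'v"
  assumes "finite E" "G1 \<subseteq> E" "G2 \<subseteq> E" "G1 \<inter> G2 = {}"
    and le: "\<And>v. indeg head G1 v \<le> n1 v" "\<And>v. indeg head G2 v \<le> n2 v"
    and sum: "\<And>v. n1 v + n2 v = indeg head E v"
  obtains H where "G1 \<subseteq> H" "H \<subseteq> E - G2"
    "\<And>v. indeg head H v = n1 v" "\<And>v. indeg head (E - H) v = n2 v"
proof -
  have fin: "finite G1" "finite G2" using assms finite_subset by blast+
  have "\<exists>S. {a\<in>G1. head a = v} \<subseteq> S \<and> S \<subseteq> {a\<in>E - G2. head a = v} \<and> card S = nat (n1 v)" for v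
  proof -
    have "indeg head (E - G2) v = n1 v + n2 v - indeg head G2 v"
      using indeg_Un_disjoint[of "E - G2" G2 head v] assms(1,3) fin sum[of v]
      by (simp add: Un_absorb2 Int_commute)
    hence "card {a\<in>G1. head a = v} \<le> nat (n1 v)" "nat (n1 v) \<le> card {a\<in>E - G2. head a = v}"
      using le[of v] unfolding indeg_def by linarith+
    thus ?thesis using assms by (intro exists_subset_between) auto
  qed
  hence "\<exists>S. \<forall>v. {a\<in>G1. head a = v} \<subseteq> S v \<and> S v \<subseteq> {a\<in>E - G2. head a = v} \<and>
      card (S v) = nat (n1 v)" by (intro choice allI)
  then obtain S where S: "\<And>v. {a\<in>G1. head a = v} \<subseteq> S v"
    "\<And>v. S v \<subseteq> {a\<in>E - G2. head a = v}" "\<And>v. card (S v) = nat (n1 v)" by blast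
  define H where "H = (\<Union>v. S v)"
  have "{a\<in>H. head a = v} = S v" for v using S(2) unfolding H_def by fastforce
  moreover have "n1 v \<ge> 0" for v using le(1)[of v] by (simp add: indeg_def)
  ultimately have n1: "indeg head H v = n1 v" for v using S(3) by (simp add: indeg_def)
  have sub: "G1 \<subseteq> H" "H \<subseteq> E - G2" using S(1,2) unfolding H_def by fastforce+
  moreover have "indeg head (E - H) v = n2 v" for v
  proof -
    have "finite H" "H \<union> (E - H) = E"
      using sub assms by (meson finite_Diff finite_subset, blast)
    thus ?thesis using indeg_Un_disjoint[of H "E - H" head v] sum[of v] n1[of v] assms(1)
      by simp
  qed
  ultimately show thesis using that n1 by blast
qed

section \<open>Redistributing the arcs of two b-branchings\<close>

text \<open>Edmonds' theorem, with the supports of \<open>s1\<close> and \<open>s2\<close> as root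
  sets, yields two sparse arc sets that secure the cut form; the remaining arcs are then handed out
  to reach the prescribed indegrees. \<open>pos\<close> serves the cut condition, and
  \<open>le_max\<close> lets both sides hold all common arcs.\<close>

lemma b_branching_redistribution:
  fixes tail head :: "'e \<Rightarrow> 'v::finite" and s1 s2 :: "'v \<Rightarrow> int"
  assumes A: "finite A"
    and B: "b_branching A tail head b B1" "b_branching A tail head b B2"
    and sum: "\<And>v. s1 v + s2 v = (b v - indeg head B1 v) + (b v - indeg head B2 v)"
    and nonneg: "\<And>v. 0 \<le> s1 v" "\<And>v. 0 \<le> s2 v"
    and le_max: "\<And>v. s1 v \<le> max (b v - indeg head B1 v) (b v - indeg head B2 v)"
      "\<And>v. s2 v \<le> max (b v - indeg head B1 v) (b v - indeg head B2 v)"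
    and pos: "\<And>X. X \<noteq> {} \<Longrightarrow> entering tail head B1 X = {} \<Longrightarrow> entering tail head B2 X = {} \<Longrightarrow>
      (\<exists>v\<in>X. s1 v > 0) \<and> (\<exists>v\<in>X. s2 v > 0)"
  obtains B1' B2' where "b_branching A tail head b B1'" "b_branching A tail head b B2'"
    "B1' \<union> B2' = B1 \<union> B2" "B1' \<inter> B2' = B1 \<inter> B2"
    "\<And>v. indeg head B1' v = b v - s1 v" "\<And>v. indeg head B2' v = b v - s2 v"
proof -
  have sub: "B1 \<subseteq> A" "B2 \<subseteq> A"
    and le: "\<And>v. indeg head B1 v \<le> b v" "\<And>v. indeg head B2 v \<le> b v"
    using B by (simp_all add: b_branching_def)
  have cut: "(\<exists>v\<in>X. indeg head B1 v < b v) \<or> entering tail head B1 X \<noteq> {}"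
    "(\<exists>v\<in>X. indeg head B2 v < b v) \<or> entering tail head B2 X \<noteq> {}" if "X \<noteq> {}" for X
    using B that unfolding b_branching_iff_entering[OF A] by simp_all
  have fin: "finite B1" "finite B2" using sub A by (auto intro: finite_subset)
  define s where "s i = (if i then s1 else s2)" for i :: bool
  define R where "R i = {v. s i v > 0}" for i
  \<comment> \<open>An arc of \<open>B1 \<inter> B2\<close> counts as two parallel arcs here; in the end one copy goes to each side.\<close>
  define D where "D = B1 <+> B2"
  let ?t = "case_sum tail tail" and ?h = "case_sum head head"
  have "card (missing R UNIV X) \<le> card (entering ?t ?h D X)" if X: "X \<noteq> {}" for X
  proof -
    let ?e1 = "entering tail head B1 X" and ?e2 = "entering tail head B2 X"
    have "entering ?t ?h D X = ?e1 <+> ?e2"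
      by (auto simp: entering_def D_def)
    moreover have fe: "finite ?e1" "finite ?e2" using fin by (auto simp: entering_def)
    ultimately have card: "card (entering ?t ?h D X) = card ?e1 + card ?e2"
      by (simp add: card_Plus)
    have "missing R UNIV X = {i. \<forall>v\<in>X. s i v \<le> 0}"
      by (force simp: missing_def R_def)
    hence miss: "card (missing R UNIV X)
        = of_bool (\<forall>v\<in>X. s1 v \<le> 0) + of_bool (\<forall>v\<in>X. s2 v \<le> 0)"
      using card_filter_eq_sum_of_bool[of "UNIV :: bool set" "\<lambda>i. \<forall>v\<in>X. s i v \<le> 0"]
      by (simp add: UNIV_bool s_def)
    show ?thesis
    \<comment> \<open>If both supports avoid \<open>X\<close>, the given deficits vanish on
      \<open>X\<close>, so each of \<open>B1\<close> and \<open>B2\<close> has an arc entering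
      \<open>X\<close>. If only one of them does, a single arc suffices and \<open>pos\<close>
      supplies it.\<close>
    proof (cases "(\<forall>v\<in>X. s1 v \<le> 0) \<and> (\<forall>v\<in>X. s2 v \<le> 0)")
      case True
      have "indeg head B1 v = b v" "indeg head B2 v = b v" if "v \<in> X" for v
      proof -
        have "s1 v \<le> 0" "s2 v \<le> 0" using True that by auto
        thus "indeg head B1 v = b v" "indeg head B2 v = b v"
          using sum[of v] nonneg[of v] le[of v] by linarith+
      qed
      hence "?e1 \<noteq> {}" "?e2 \<noteq> {}" using cut[OF X] by auto
      hence "card ?e1 > 0" "card ?e2 > 0" using fe by (auto simp: card_gt_0_iff)
      thus ?thesis using card miss by simp
    next
      case False
      hence "?e1 \<noteq> {} \<or> ?e2 \<noteq> {}" if "card (missing R UNIV X) > 0"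
        using that pos[OF X] miss by (auto simp: not_less[symmetric])
      hence "card ?e1 + card ?e2 > 0" if "card (missing R UNIV X) > 0"
        using that fe by (auto simp: card_gt_0_iff)
      moreover have "card (missing R UNIV X) \<le> 1" using False miss by auto
      ultimately show ?thesis using card by linarith
    qed
  qed
  moreover have "finite D" using fin by (simp add: D_def)
  ultimately obtain F where
    "(\<forall>i\<in>UNIV. F i \<subseteq> D) \<and> disjoint_family_on F UNIV \<and>
      (\<forall>i\<in>UNIV. \<forall>X. X \<noteq> {} \<longrightarrow> R i \<inter> X = {} \<longrightarrow> entering ?t ?h (F i) X \<noteq> {}) \<and>
      (\<forall>i\<in>UNIV. \<forall>v. card {a\<in>F i. ?h a = v} \<le> of_bool (v \<notin> R i))"
    using edmonds_disjoint_branchings[where D = D and R = R and tail = ?t and head = ?h, OF finite]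
    by presburger
  hence F: "\<And>i. F i \<subseteq> D" "F True \<inter> F False = {}"
    "\<And>i X. X \<noteq> {} \<Longrightarrow> R i \<inter> X = {} \<Longrightarrow> entering ?t ?h (F i) X \<noteq> {}"
    "\<And>i v. card {a\<in>F i. ?h a = v} \<le> of_bool (v \<notin> R i)"
    using disjoint_family_onD[of F UNIV True False] by simp_all
  \<comment> \<open>The common arcs \<open>C\<close> go to both sides, so only the symmetric
    difference \<open>E\<close> has to be divided. \<open>G i\<close> keeps the part of
    \<open>F i\<close> over \<open>E\<close>. The sets \<open>G i\<close> stay disjoint because an
    arc of \<open>E\<close> has just one copy in \<open>D\<close>.\<close>
  define C where "C = B1 \<inter> B2"
  define E where "E = (B1 - B2) \<union> (B2 - B1)"
  define G where "G i = {e\<in>E. Inl e \<in> F i \<or> Inr e \<in> F i}" for i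
  have finCE: "finite C" "finite E" using fin by (auto simp: C_def E_def)
  have G: "G i \<subseteq> E" for i by (auto simp: G_def)
  have disj: "G True \<inter> G False = {}"
    using F(1)[of True] F(1)[of False] F(2) by (auto simp: G_def E_def D_def)
  have ent: "entering tail head (C \<union> G i) X \<noteq> {}" if X: "X \<noteq> {}" "\<forall>v\<in>X. s i v \<le> 0" for i X
  proof -
    have "R i \<inter> X = {}" using X by (force simp: R_def)
    then obtain a where "a \<in> entering ?t ?h (F i) X" using F(3) X by blast
    hence "case_sum id id a \<in> entering tail head (C \<union> G i) X" using F(1)[of i]
      by (cases a) (auto simp: entering_def C_def G_def E_def D_def)
    thus ?thesis by blast
  qed
  have degG: "indeg head (G i) v \<le> of_bool (v \<notin> R i)" for i v
  proof -
    have finF: "finite {a\<in>F i. ?h a = v}"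
      using F(1)[of i] fin unfolding D_def by (auto intro: finite_subset)
    have "{a\<in>G i. head a = v} \<subseteq> case_sum id id ` {a\<in>F i. ?h a = v}"
      by (force simp: G_def image_iff)
    hence "card {a\<in>G i. head a = v} \<le> card {a\<in>F i. ?h a = v}"
      using finF by (meson card_image_le card_mono finite_imageI order_trans)
    also note F(4)[of i v]
    finally have "card {a\<in>G i. head a = v} \<le> of_bool (v \<notin> R i)" .
    thus ?thesis unfolding indeg_def by (auto split: if_splits)
  qed
  \<comment> \<open>The number of arcs of \<open>E\<close> into \<open>v\<close> that side
    \<open>i\<close> must receive, besides \<open>C\<close>, to have deficit
    \<open>s i v\<close>.\<close>
  define n where "n i v = b v - s i v - indeg head C v" for i v
  have degE: "n True v + n False v = indeg head E v" for v
  proof -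
    have "indeg head B1 v = indeg head C v + indeg head (B1 - B2) v"
      "indeg head B2 v = indeg head C v + indeg head (B2 - B1) v"
      using indeg_Un_disjoint[of C "B1 - B2" head v] indeg_Un_disjoint[of C "B2 - B1" head v] fin
        Int_Diff_Un[of B1 B2] Int_Diff_Un[of B2 B1] by (auto simp: C_def Int_commute)
    moreover have "indeg head E v = indeg head (B1 - B2) v + indeg head (B2 - B1) v"
      unfolding E_def using fin by (intro indeg_Un_disjoint) auto
    ultimately show ?thesis using sum[of v] by (simp add: n_def s_def)
  qed
  have n_nonneg: "n i v \<ge> 0" for i v
    using indeg_mono[OF fin(1), of C head v] indeg_mono[OF fin(2), of C head v] le_max[of v]
    by (auto simp: C_def n_def s_def)
  \<comment> \<open>At a root, \<open>G i\<close> has no arc into \<open>v\<close>. Elsewhere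
    \<open>s i v\<close> is zero, so \<open>n i v\<close> is the larger of the two shares; if
    \<open>G i\<close> has an arc into \<open>v\<close>, the shares have a positive sum and the
    larger one is at least 1.\<close>
  have "indeg head (G i) v \<le> n i v" for i v
  proof (cases "v \<in> R i")
    case True
    thus ?thesis using degG[of i v] n_nonneg[of i v] by simp
  next
    case False
    hence "s i v \<le> s (\<not> i) v" using nonneg[of v] by (auto simp: R_def s_def)
    hence "n (\<not> i) v \<le> n i v" by (simp add: n_def)
    moreover have "indeg head (G i) v \<le> n i v + n (\<not> i) v"
      using indeg_mono[OF finCE(2) G[of i], of head v] degE[of v] by (cases i) auto
    moreover have "indeg head (G i) v \<le> 1" using degG[of i v] False by simp
    ultimately show ?thesis by linarith
  qed
  with split_with_indeg[OF finCE(2) G G disj _ _ degE] obtain H where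
    H: "G True \<subseteq> H" "H \<subseteq> E - G False"
      "\<And>v. indeg head H v = n True v" "\<And>v. indeg head (E - H) v = n False v" by blast
  have finH: "finite H" using H(2) finCE by (meson finite_Diff finite_subset)
  have deg: "indeg head (C \<union> H) v = b v - s1 v" "indeg head (C \<union> (E - H)) v = b v - s2 v" for v
  proof -
    have "C \<inter> H = {}" "C \<inter> (E - H) = {}" using H(2) by (auto simp: C_def E_def)
    thus "indeg head (C \<union> H) v = b v - s1 v" "indeg head (C \<union> (E - H)) v = b v - s2 v"
      using H(3)[of v] H(4)[of v] finCE finH by (auto simp: indeg_Un_disjoint n_def s_def)
  qed
  have sub': "C \<union> H \<subseteq> A" "C \<union> (E - H) \<subseteq> A"
    using sub H(2) by (auto simp: C_def E_def)
  have GH: "C \<union> G True \<subseteq> C \<union> H" "C \<union> G False \<subseteq> C \<union> (E - H)"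
    using H(1,2) G disj by blast+
  show thesis
  proof (rule that)
    show "b_branching A tail head b (C \<union> H)"
      unfolding b_branching_iff_entering[OF A] deg
    proof (intro conjI allI impI)
      fix X :: "'v set" assume X: "X \<noteq> {}"
      show "(\<exists>v\<in>X. b v - s1 v < b v) \<or> entering tail head (C \<union> H) X \<noteq> {}"
        using ent[OF X, of True] GH(1) by (force simp: s_def entering_def)
    qed (use sub' nonneg in auto)
    show "b_branching A tail head b (C \<union> (E - H))"
      unfolding b_branching_iff_entering[OF A] deg
    proof (intro conjI allI impI)
      fix X :: "'v set" assume X: "X \<noteq> {}"
      show "(\<exists>v\<in>X. b v - s2 v < b v) \<or> entering tail head (C \<union> (E - H)) X \<noteq> {}"
        using ent[OF X, of False] GH(2) by (force simp: s_def entering_def)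
    qed (use sub' nonneg in auto)
    show "(C \<union> H) \<union> (C \<union> (E - H)) = B1 \<union> B2" "(C \<union> H) \<inter> (C \<union> (E - H)) = B1 \<inter> B2"
      using H(2) by (auto simp: C_def E_def)
  qed (rule deg)+
qed

section \<open>Exchange between two b-branchings\<close>

text \<open>This is the exchange property for exact deficits, where raising an indegree lowers a
  deficit. In \<open>swap\<close> the deficit at \<open>v\<close> is zero for \<open>B1\<close> and
  positive for \<open>B2\<close>, so \<open>v\<close> lies in the negative support of the difference
  of deficits.\<close>

lemma b_branching_exchange:
  fixes tail head :: "'e \<Rightarrow> 'v::finite" and w :: "'e \<Rightarrow> real"
  assumes A: "finite A"
    and B: "b_branching A tail head b B1" "b_branching A tail head b B2"
    and u: "indeg head B1 u < indeg head B2 u"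
  obtains (shift) B1' B2' where
      "b_branching A tail head b B1'" "b_branching A tail head b B2'"
      "sum w B1' + sum w B2' = sum w B1 + sum w B2"
      "\<And>i. indeg head B1' i = indeg head B1 i + unitv u i"
      "\<And>i. indeg head B2' i = indeg head B2 i - unitv u i"
    | (swap) B1' B2' v where
      "b_branching A tail head b B1'" "b_branching A tail head b B2'"
      "sum w B1' + sum w B2' = sum w B1 + sum w B2"
      "indeg head B1 v = b v" "indeg head B2 v < b v"
      "\<And>i. indeg head B1' i = indeg head B1 i + unitv u i - unitv v i"
      "\<And>i. indeg head B2' i = indeg head B2 i - unitv u i + unitv v i"
proof -
  have sub: "B1 \<subseteq> A" "B2 \<subseteq> A"
    and le: "\<And>v. indeg head B1 v \<le> b v" "\<And>v. indeg head B2 v \<le> b v"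
    using B by (simp_all add: b_branching_def)
  have cut: "(\<exists>v\<in>X. indeg head B1 v < b v) \<or> entering tail head B1 X \<noteq> {}"
    "(\<exists>v\<in>X. indeg head B2 v < b v) \<or> entering tail head B2 X \<noteq> {}" if "X \<noteq> {}" for X
    using B that unfolding b_branching_iff_entering[OF A] by simp_all
  have fin: "finite B1" "finite B2" using sub A by (auto intro: finite_subset)
  have weight: "sum w B1' + sum w B2' = sum w B1 + sum w B2"
    if "b_branching A tail head b B1'" "b_branching A tail head b B2'"
      "B1' \<union> B2' = B1 \<union> B2" "B1' \<inter> B2' = B1 \<inter> B2" for B1' B2'
  proof -
    have "finite B1'" "finite B2'"
      using that A by (auto simp: b_branching_def intro: finite_subset)
    thus ?thesis using sum.union_inter[of B1' B2' w] sum.union_inter[of B1 B2 w] fin that(3,4)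
      by simp
  qed
  define r1 where "r1 v = b v - indeg head B1 v" for v
  define r2 where "r2 v = b v - indeg head B2 v" for v
  have nonneg: "r1 v \<ge> 0" "r2 v \<ge> 0" for v using le by (auto simp: r1_def r2_def)
  have r_u: "r2 u < r1 u" using u by (simp add: r1_def r2_def)
  define closed where
    "closed X \<longleftrightarrow> entering tail head B1 X = {} \<and> entering tail head B2 X = {}" for X
  have pos: "(\<exists>v\<in>X. r1 v > 0) \<and> (\<exists>v\<in>X. r2 v > 0)" if "X \<noteq> {}" "closed X" for X
    using cut[OF that(1)] that(2) by (simp add: r1_def r2_def closed_def)
  show thesis
  \<comment> \<open>Such an \<open>X\<close> is the only obstruction to \<open>shift\<close>:
    removing a unit at \<open>u\<close> would leave no deficit of the first b-branching on a closed
    set.\<close>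
  proof (cases "\<exists>X. closed X \<and> u \<in> X \<and> r1 u \<le> 1 \<and> (\<forall>v\<in>X - {u}. r1 v \<le> 0)")
    case False
    define s1 where "s1 i = r1 i - unitv u i" for i
    define s2 where "s2 i = r2 i + unitv u i" for i
    have s_pos: "(\<exists>v\<in>X. s1 v > 0) \<and> (\<exists>v\<in>X. s2 v > 0)" if X: "X \<noteq> {}" "closed X" for X
    proof
      have "s2 v \<ge> r2 v" for v by (simp add: s2_def unitv_def)
      thus "\<exists>v\<in>X. s2 v > 0" using pos[OF X] by (meson less_le_trans)
      show "\<exists>v\<in>X. s1 v > 0"
      proof (cases "u \<in> X")
        case True
        with False X have "r1 u > 1 \<or> (\<exists>v\<in>X - {u}. r1 v > 0)" by force
        thus ?thesis using True by (auto simp: s1_def unitv_def)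
      next
        case False
        hence "\<forall>v\<in>X. s1 v = r1 v" by (auto simp: s1_def unitv_def)
        thus ?thesis using pos[OF X] by simp
      qed
    qed
    have bounds: "s1 v + s2 v = r1 v + r2 v" "0 \<le> s1 v" "0 \<le> s2 v"
      "s1 v \<le> max (r1 v) (r2 v)" "s2 v \<le> max (r1 v) (r2 v)" for v
      using nonneg[of v] r_u nonneg[of u] by (auto simp: s1_def s2_def unitv_def)
    obtain B1' B2' where
      "b_branching A tail head b B1'" "b_branching A tail head b B2'"
      "B1' \<union> B2' = B1 \<union> B2" "B1' \<inter> B2' = B1 \<inter> B2"
      "\<And>v. indeg head B1' v = b v - s1 v" "\<And>v. indeg head B2' v = b v - s2 v"
      by (rule b_branching_redistribution[OF A B bounds(1)[unfolded r1_def r2_def] bounds(2,3)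
            bounds(4,5)[unfolded r1_def r2_def] s_pos[unfolded closed_def, OF _ conjI]])
        (assumption+, rule that)
    thus thesis
      by (intro shift[of B1' B2'] weight) (auto simp: s1_def s2_def r1_def r2_def)
  next
    case True
    then obtain X where X: "closed X" "u \<in> X" "r1 u \<le> 1" "\<forall>v\<in>X - {u}. r1 v \<le> 0" by blast
    have r_u': "r1 u = 1" "r2 u = 0" using X(3) r_u nonneg[of u] by auto
    \<comment> \<open>Closed sets are stable under intersection, so \<open>X0\<close> is the
      smallest closed set containing \<open>u\<close>. By \<open>X0 \<subseteq> X\<close>,
      \<open>r1\<close> vanishes on \<open>X0\<close> except at \<open>u\<close>, while
      \<open>pos\<close> provides \<open>v\<close> in \<open>X0\<close> with
      \<open>r2 v > 0\<close>.\<close>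
    define X0 where "X0 = \<Inter>{Y. closed Y \<and> u \<in> Y}"
    have "closed X0" "u \<in> X0" unfolding X0_def closed_def entering_def by blast+
    have "X0 \<subseteq> X" using X by (auto simp: X0_def)
    obtain v where v: "v \<in> X0" "r2 v > 0" using pos[of X0] \<open>closed X0\<close> \<open>u \<in> X0\<close> by blast
    have "v \<noteq> u" using v r_u' by auto
    have "r1 v = 0" using v \<open>v \<noteq> u\<close> \<open>X0 \<subseteq> X\<close> X(4) nonneg(1)[of v] by force
    define s1 where "s1 i = r1 i - unitv u i + unitv v i" for i
    define s2 where "s2 i = r2 i + unitv u i - unitv v i" for i
    have s_pos: "(\<exists>v\<in>Y. s1 v > 0) \<and> (\<exists>v\<in>Y. s2 v > 0)" if Y: "Y \<noteq> {}" "closed Y" for Y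
    proof
      show "\<exists>i\<in>Y. s1 i > 0"
      proof (cases "u \<in> Y")
        case True
        hence "v \<in> Y" using v Y by (auto simp: X0_def)
        moreover have "s1 v > 0" using \<open>r1 v = 0\<close> \<open>v \<noteq> u\<close> by (simp add: s1_def unitv_def)
        ultimately show ?thesis by blast
      next
        case False
        hence "\<forall>i\<in>Y. s1 i \<ge> r1 i" by (auto simp: s1_def unitv_def)
        thus ?thesis using pos[OF Y] by (meson less_le_trans)
      qed
      show "\<exists>i\<in>Y. s2 i > 0"
      proof (cases "v \<in> Y")
        case True
        \<comment> \<open>The unit removed at \<open>v\<close> might be the only one of
          \<open>r2\<close> in \<open>Y\<close>. But the nonempty closed set
          \<open>X0 \<inter> Y\<close> carries positive \<open>r1\<close>, which is possible only at
          \<open>u\<close>; hence \<open>Y\<close> contains \<open>u\<close>, where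
          \<open>s2\<close> has gained a unit.\<close>
        have "closed (X0 \<inter> Y)" using \<open>closed X0\<close> Y unfolding closed_def entering_def by blast
        moreover have "X0 \<inter> Y \<noteq> {}" using True v by blast
        ultimately obtain i where "i \<in> X0 \<inter> Y" "r1 i > 0" using pos[of "X0 \<inter> Y"] by blast
        hence "u \<in> Y" using X(4) \<open>X0 \<subseteq> X\<close> by force
        moreover have "s2 u > 0" using r_u' \<open>v \<noteq> u\<close> by (simp add: s2_def unitv_def)
        ultimately show ?thesis by blast
      next
        case False
        hence "\<forall>i\<in>Y. s2 i \<ge> r2 i" by (auto simp: s2_def unitv_def)
        thus ?thesis using pos[OF Y] by (meson less_le_trans)
      qed
    qed
    have bounds: "s1 i + s2 i = r1 i + r2 i" "0 \<le> s1 i" "0 \<le> s2 i"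
      "s1 i \<le> max (r1 i) (r2 i)" "s2 i \<le> max (r1 i) (r2 i)" for i
      using nonneg[of i] r_u' v \<open>r1 v = 0\<close> \<open>v \<noteq> u\<close> by (auto simp: s1_def s2_def unitv_def)
    obtain B1' B2' where
      "b_branching A tail head b B1'" "b_branching A tail head b B2'"
      "B1' \<union> B2' = B1 \<union> B2" "B1' \<inter> B2' = B1 \<inter> B2"
      "\<And>v. indeg head B1' v = b v - s1 v" "\<And>v. indeg head B2' v = b v - s2 v"
      by (rule b_branching_redistribution[OF A B bounds(1)[unfolded r1_def r2_def] bounds(2,3)
            bounds(4,5)[unfolded r1_def r2_def] s_pos[unfolded closed_def, OF _ conjI]])
        (assumption+, rule that)
    thus thesis using v \<open>r1 v = 0\<close>
      by (intro swap[of B1' B2' v] weight) (auto simp: s1_def s2_def r1_def r2_def)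
  qed
qed

section \<open>Minimizers and the exchange property of \<open>gfun\<close>\<close>

lemma finite_feas: "finite A \<Longrightarrow> finite (feas A tail head b x)"
  by (rule finite_subset[of _ "Pow A"]) (auto simp: feas_def b_branching_def)

lemma gfun_le:
  assumes "finite A" "\<And>v. x v \<ge> 0" "B \<in> feas A tail head b x"
  shows "gfun A tail head w b x \<le> ereal (sum w B)"
  using assms finite_feas[OF assms(1), of tail head b x] by (auto simp: gfun_def)

lemma gfun_attained:
  assumes "finite A" "gfun A tail head w b x \<noteq> \<infinity>"
  obtains B where "\<And>v. x v \<ge> 0" "B \<in> feas A tail head b x"
    "gfun A tail head w b x = ereal (sum w B)"
proof -
  have x: "\<forall>v. x v \<ge> 0" "feas A tail head b x \<noteq> {}"
    using assms(2) by (auto simp: gfun_def split: if_splits)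
  hence "Min (sum w ` feas A tail head b x) \<in> sum w ` feas A tail head b x"
    using finite_feas[OF assms(1), of tail head b x] by (intro Min_in finite_imageI) auto
  with x show thesis using that by (auto simp: gfun_def)
qed

theorem mainTheorem7:
  fixes A :: "'e set" and tail head :: "'e \<Rightarrow> 'v::finite"
    and w :: "'e \<Rightarrow> real" and b :: "'v \<Rightarrow> int"
  assumes "digraph A tail head"
    and "\<forall>a\<in>A. w a \<ge> 0"
    and "\<forall>v. b v > 0"
  shows "Mnat_convex (gfun A tail head w b)"
proof -
  have A: "finite A" using assms(1) by (simp add: digraph_def)
  let ?g = "gfun A tail head w b"
  have not_minf: "?g x \<noteq> -\<infinity>" for x by (simp add: gfun_def)
  have "?g x + ?g y \<ge> ?g (\<lambda>i. x i - unitv u i) + ?g (\<lambda>i. y i + unitv u i) \<or>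
      (\<exists>v\<in>supp_neg (\<lambda>i. x i - y i). ?g x + ?g y \<ge>
        ?g (\<lambda>i. x i - unitv u i + unitv v i) + ?g (\<lambda>i. y i + unitv u i - unitv v i))"
    (is "?shift \<or> (\<exists>v\<in>_. ?swap v)") if u: "u \<in> supp_pos (\<lambda>i. x i - y i)" for x y u
  proof (cases "?g x = \<infinity> \<or> ?g y = \<infinity>")
    case True
    hence eq: "?g x + ?g y = \<infinity>" using not_minf by auto
    have ?shift unfolding eq by simp
    thus ?thesis ..
  next
    case False
    obtain B1 where x: "\<And>v. x v \<ge> 0" and B1: "B1 \<in> feas A tail head b x"
      and gx: "?g x = ereal (sum w B1)" using False gfun_attained[OF A] by metis
    obtain B2 where y: "\<And>v. y v \<ge> 0" and B2: "B2 \<in> feas A tail head b y"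
      and gy: "?g y = ereal (sum w B2)" using False gfun_attained[OF A] by metis
    have bb: "b_branching A tail head b B1" "b_branching A tail head b B2"
      and deg: "\<And>v. b v - indeg head B1 v \<le> x v" "\<And>v. b v - indeg head B2 v \<le> y v"
      using B1 B2 by (auto simp: feas_def algebra_simps)
    have uxy: "y u < x u" "1 \<le> x u" using u y[of u] by (simp_all add: supp_pos_def)
    \<comment> \<open>Each alternative is thereby reduced to exhibiting two b-branchings of
      unchanged total weight whose deficits are dominated by the new nonnegative arguments.\<close>
    have bound: "?g x' + ?g y' \<le> ?g x + ?g y"
      if "b_branching A tail head b B1'" "b_branching A tail head b B2'"
        "sum w B1' + sum w B2' = sum w B1 + sum w B2"
        "\<And>v. x' v \<ge> 0" "\<And>v. y' v \<ge> 0"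
        "\<And>v. b v - indeg head B1' v \<le> x' v" "\<And>v. b v - indeg head B2' v \<le> y' v"
      for x' y' B1' B2'
    proof -
      have "B1' \<in> feas A tail head b x'" "B2' \<in> feas A tail head b y'"
        using that by (auto simp: feas_def algebra_simps)
      hence "?g x' + ?g y' \<le> ereal (sum w B1') + ereal (sum w B2')"
        using that by (intro add_mono gfun_le A)
      thus ?thesis using that(3) gx gy by simp
    qed
    show ?thesis
    \<comment> \<open>With slack at \<open>u\<close>, the pair \<open>B1\<close>, \<open>B2\<close>
      itself witnesses \<open>?shift\<close>. Without slack, \<open>x u\<close> is the deficit of
      \<open>B1\<close> at \<open>u\<close>, and \<open>y u < x u\<close> makes the deficit of
      \<open>B2\<close> there smaller.\<close>
    proof (cases "b u - indeg head B1 u < x u")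
      case True
      have ?shift
        by (rule bound[OF bb refl]) (use x y deg True uxy in \<open>auto simp: unitv_def add_increasing2 le_diff_eq\<close>)
      thus ?thesis ..
    next
      case False
      hence "indeg head B1 u < indeg head B2 u" using uxy(1) deg[of u] by linarith
      from A bb this show ?thesis
      proof (cases rule: b_branching_exchange[where w = w])
        case (shift B1' B2')
        have ?shift
          by (rule bound[OF shift(1-3)]) (use x y deg shift(4,5) uxy in \<open>auto simp: unitv_def\<close>)
        thus ?thesis ..
      next
        case (swap B1' B2' v)
        have "u \<noteq> v" using swap(4,5) \<open>indeg head B1 u < indeg head B2 u\<close> by auto
        show ?thesis
        \<comment> \<open>Only \<open>x v < y v\<close> makes \<open>v\<close> an admissible
          partner. Otherwise \<open>x v\<close> is at least \<open>y v\<close>, hence at least the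
          positive deficit of \<open>B2\<close> at \<open>v\<close>, so it already covers the unit
          deficit that \<open>B1'\<close> has at \<open>v\<close>. The swapped pair then witnesses
          \<open>?shift\<close>.\<close>
        proof (cases "x v < y v")
          case True
          hence "1 \<le> y v" using x[of v] by linarith
          have "?swap v"
            by (rule bound[OF swap(1-3)])
               (use x y deg swap(4-7) uxy \<open>u \<noteq> v\<close> \<open>1 \<le> y v\<close> in \<open>auto simp: unitv_def\<close>)
          thus ?thesis using True by (auto simp: supp_neg_def)
        next
          case False
          hence v: "1 \<le> x v" "b v - indeg head B2 v - 1 \<le> y v"
            using deg(2)[of v] swap(5) by linarith+
          have ?shift
            by (rule bound[OF swap(1-3)])
               (use x y deg swap(4-7) uxy \<open>u \<noteq> v\<close> v in \<open>auto simp: unitv_def\<close>)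
          thus ?thesis ..
        qed
      qed
    qed
  qed
  thus ?thesis using not_minf by (simp add: Mnat_convex_def)
qed

end
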